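(* There exists $n_0$ such that for every $n\geq n_0$, the maximum of $s_Q(G)$ over all connected graphs $G$ on $n$ vertices is attained by $K_{n-1}^+$, and $K_{n-1}^+$ is, up to isomorphism, the unique connected graph on $n$ vertices attaining this maximum.
   Context: All graphs are finite and simple. The signless Laplacian of a graph $G$ is $Q(G)=D(G)+A(G)$, where $A(G)$ is the adjacency matrix and $D(G)$ the diagonal matrix of vertex degrees; its eigenvalues are $q_1(G)\geq\cdots\geq q_n(G)$. The $Q$-spread of $G$ is $s_Q(G)=q_1(G)-q_n(G)$. $K_{n-1}^+$ is the $n$-vertex graph formed by adding a pendant edge to the complete graph $K_{n-1}$, i.e. by adding one new vertex adjacent to exactly one vertex of $K_{n-1}$. *)

theory Defs
  imports
    "Graph_Theory.Graph_Theory"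
    "Jordan_Normal_Form.Char_Poly"
    "HOL-Library.Multiset"
begin

text \<open>
  A finite simple graph is a symmetric loop-free digraph whose arcs are pairs of vertices
  (locale \<open>pair_graph\<close>): an edge \<open>uv\<close> is represented by the two arcs \<open>(u, v)\<close> and \<open>(v, u)\<close>,
  so the degree of a vertex is its out-degree.  Graphs on \<open>n\<close> vertices are taken with vertex
  set \<open>{0..<n}\<close>, which also indexes the rows and columns of the matrices below.
\<close>

type_synonym ngraph = "nat pair_pre_digraph"

definition connected_graph_on :: "nat \<Rightarrow> ngraph \<Rightarrow> bool" where
  "connected_graph_on n G \<longleftrightarrow>
     pair_graph G \<and> pverts G = {0..<n} \<and> Digraph_Component.connected (with_proj G)"

definition adjacency_mat :: "ngraph \<Rightarrow> real mat" where
  "adjacency_mat G =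
     (let n = card (pverts G) in mat n n (\<lambda>(i, j). if (i, j) \<in> parcs G then 1 else 0))"

definition degree_mat :: "ngraph \<Rightarrow> real mat" where
  "degree_mat G = mat_diag (card (pverts G)) (\<lambda>i. real (out_degree (with_proj G) i))"

definition signless_laplacian :: "ngraph \<Rightarrow> real mat" where
  "signless_laplacian G = degree_mat G + adjacency_mat G"

text \<open>
  The eigenvalues, repeated according to multiplicity, in nonincreasing order.  For a graph on
  \<open>n\<close> vertices the matrix is real symmetric, so its characteristic polynomial has \<open>n\<close> real roots
  and the list has length \<open>n\<close>.
\<close>

definition Q_eigenvalues :: "ngraph \<Rightarrow> real list" where
  "Q_eigenvalues G = rev (sorted_list_of_multiset (proots (char_poly (signless_laplacian G))))"

text \<open>\<open>Q_eig i G\<close> is the \<open>i\<close>-th largest eigenvalue, where \<open>1 \<le> i \<le> n\<close>.\<close>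

definition Q_eig :: "nat \<Rightarrow> ngraph \<Rightarrow> real" where
  "Q_eig i G = Q_eigenvalues G ! (i - 1)"

definition Q_spread :: "ngraph \<Rightarrow> real" where
  "Q_spread G = Q_eig 1 G - Q_eig (card (pverts G)) G"

text \<open>
  For \<open>n \<ge> 2\<close>: the complete graph on \<open>{0..<n - 1}\<close> with the new vertex \<open>n - 1\<close> joined to the
  vertex \<open>0\<close> only.
\<close>

definition K_plus :: "nat \<Rightarrow> ngraph" where
  "K_plus n =
     \<lparr> pverts = {0..<n},
       parcs = {(u, v). u < n - 1 \<and> v < n - 1 \<and> u \<noteq> v} \<union> {(0, n - 1), (n - 1, 0)} \<rparr>"

end

theory Submission
  imports Defs "HOL-Analysis.Convex" "HOL-Analysis.Function_Topology"
begin

text \<open>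
  Let \<open>H\<close> be the complement of \<open>G\<close>. Weighting AM-GM by the degrees gives
  \<open>q\<^sub>1(G) \<le> 2n - 2 - 2e(H)/(n - 1)\<close>, while testing the Rayleigh quotient shows that \<open>K_plus n\<close> has
  spread at least \<open>2n - 5\<close>. So a connected \<open>G\<close> whose spread is not smaller has
  \<open>2e(H)/(n - 1) + q\<^sub>n(G) \<le> 3\<close>; in particular \<open>H\<close> has at most \<open>3(n - 1)/2\<close> edges. Since
  \<open>Q(G) = (n - 2)I + J - Q(H)\<close> and the largest eigenvalue of \<open>Q(H)\<close> is at most
  \<open>\<Delta>(H) + sqrt (2e(H))\<close>, some vertex \<open>w\<close> has degree \<open>n - O(sqrt n)\<close> in \<open>H\<close>. The form of \<open>G - w\<close> is
  then at least \<open>n/4\<close> times the squared norm, which forces \<open>q\<^sub>n(G) \<ge> 3/2\<close> unless \<open>w\<close> is pendant in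
  \<open>G\<close>; but \<open>q\<^sub>n(G) \<ge> 3/2\<close> contradicts the bound above.

  If \<open>w\<close> is pendant, \<open>G\<close> is a subgraph of a copy of \<open>K_plus n\<close>. Away from \<open>w\<close> a unit eigenvector \<open>y\<close>
  of \<open>q\<^sub>n\<close> has entries \<open>O(1/n)\<close>, while the Perron vector \<open>x\<close> has entries of order at least
  \<open>1/sqrt n\<close>. Adding the missing edges \<open>uv\<close> changes the spread by at least the sum of
  \<open>(x\<^sub>u + x\<^sub>v)\<^sup>2 - (y\<^sub>u + y\<^sub>v)\<^sup>2 > 0\<close>.
\<close>

section \<open>Extreme eigenvalues of real symmetric matrices\<close>

definition quad_form :: "nat \<Rightarrow> (nat \<Rightarrow> nat \<Rightarrow> real) \<Rightarrow> (nat \<Rightarrow> real) \<Rightarrow> real" where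
  "quad_form n a x = (\<Sum>i\<in>{0..<n}. \<Sum>j\<in>{0..<n}. a i j * x i * x j)"

definition sqnorm :: "'a set \<Rightarrow> ('a \<Rightarrow> real) \<Rightarrow> real" where
  "sqnorm V x = (\<Sum>i\<in>V. (x i)^2)"

lemma sqnorm_nonneg [simp]: "0 \<le> sqnorm V x"
  by (simp add: sqnorm_def sum_nonneg)

lemma sqnorm_eq_0: "finite V \<Longrightarrow> sqnorm V x = 0 \<Longrightarrow> i \<in> V \<Longrightarrow> x i = 0"
  by (simp add: sqnorm_def sum_nonneg_eq_0_iff)

lemma quad_form_max_exists:
  assumes "n > 0"
  shows "\<exists>x. sqnorm {0..<n} x = 1 \<and> (\<forall>y. quad_form n a y \<le> quad_form n a x * sqnorm {0..<n} y)"
proof -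
  let ?K = "\<lambda>i::nat. if i < n then {-1..1::real} else {0}"
  define S where "S = PiE UNIV ?K \<inter> {x. sqnorm {0..<n} x = 1}"
  have "compactin (product_topology (\<lambda>i. euclidean) UNIV) (PiE UNIV ?K)"
    by (subst compactin_PiE) (auto simp: compactin_euclidean_iff)
  hence "compact (PiE UNIV ?K)"
    by (simp only: euclidean_product_topology compactin_euclidean_iff)
  moreover have "closed {x::nat\<Rightarrow>real. sqnorm {0..<n} x = 1}"
    unfolding sqnorm_def
    by (intro closed_Collect_eq continuous_intros continuous_on_product_coordinates)
  ultimately have "compact S" unfolding S_def by (rule compact_Int_closed)
  moreover have "S \<noteq> {}"
  proof -
    have "(\<lambda>i. if i = 0 then 1 else 0) \<in> S"
      using assms by (auto simp: S_def sqnorm_def if_distrib[of "\<lambda>x. x^2"] cong: if_cong)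
    thus ?thesis by blast
  qed
  moreover have "continuous_on S (quad_form n a)"
    unfolding quad_form_def
    by (intro continuous_intros continuous_on_subset[OF continuous_on_product_coordinates]) auto
  ultimately obtain x where x: "x \<in> S" "\<forall>y\<in>S. quad_form n a y \<le> quad_form n a x"
    using continuous_attains_sup by metis
  show ?thesis
  proof (intro exI[of _ x] conjI allI)
    show "sqnorm {0..<n} x = 1" using x(1) by (simp add: S_def)
    fix y
    show "quad_form n a y \<le> quad_form n a x * sqnorm {0..<n} y"
    proof (cases "sqnorm {0..<n} y = 0")
      case True
      hence "\<And>i. i \<in> {0..<n} \<Longrightarrow> y i = 0" by (rule sqnorm_eq_0[rotated]) auto
      hence "quad_form n a y = 0" by (simp add: quad_form_def)
      thus ?thesis using True by simp
    next
      case False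
      define N where "N = sqnorm {0..<n} y"
      have N: "N > 0" using False sqnorm_nonneg[of "{0..<n}" y] unfolding N_def by linarith
      define z where "z = (\<lambda>i. if i < n then y i / sqrt N else 0)"
      have "sqnorm {0..<n} z = (\<Sum>i\<in>{0..<n}. (y i)^2 / N)"
        unfolding sqnorm_def z_def using N by (intro sum.cong) (auto simp: power_divide)
      also have "\<dots> = 1" using N by (simp add: N_def sqnorm_def flip: sum_divide_distrib)
      finally have nz: "sqnorm {0..<n} z = 1" .
      have "\<bar>z i\<bar> \<le> 1" if "i < n" for i
      proof -
        have "(z i)^2 \<le> sqnorm {0..<n} z"
          unfolding sqnorm_def using that by (intro member_le_sum) auto
        thus ?thesis using nz by (simp add: abs_square_le_1)
      qed
      hence "- 1 \<le> z i \<and> z i \<le> 1" if "i < n" for i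
        using that by (fastforce simp only: abs_le_iff minus_le_iff)
      hence "z i \<in> (if i < n then {-1..1} else {0})" for i
        by (cases "i < n") (simp_all, simp add: z_def)
      hence "z \<in> S" using nz by (auto simp: S_def)
      hence "quad_form n a z \<le> quad_form n a x" using x(2) by blast
      moreover have "quad_form n a z = quad_form n a y / N"
        unfolding quad_form_def sum_divide_distrib z_def using N
        by (intro sum.cong) (auto simp: field_simps)
      ultimately show ?thesis using N unfolding N_def[symmetric] by (simp add: field_simps)
    qed
  qed
qed

lemma quad_form_max_eigen:
  assumes sym: "\<And>i j. i < n \<Longrightarrow> j < n \<Longrightarrow> a i j = a j i"
    and le: "\<And>y. quad_form n a y \<le> M * sqnorm {0..<n} y"
    and eq: "quad_form n a x = M * sqnorm {0..<n} x" and "i < n"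
  shows "(\<Sum>j\<in>{0..<n}. a i j * x j) = M * x i"
proof -
  let ?V = "{0..<n}"
  define r where "r = (\<lambda>i. M * x i - (\<Sum>j\<in>?V. a i j * x j))"
  define B where "B = (\<lambda>y. M * sqnorm ?V y - quad_form n a y)"
  have Bge: "B y \<ge> 0" for y using le by (simp add: B_def)
  have Bx: "B x = 0" using eq by (simp add: B_def)
  have q: "quad_form n a (\<lambda>i. x i + t * r i) =
     quad_form n a x + 2 * t * (\<Sum>i\<in>?V. r i * (\<Sum>j\<in>?V. a i j * x j)) + t^2 * quad_form n a r" for t
  proof -
    have "(\<Sum>i\<in>?V. \<Sum>j\<in>?V. a i j * x i * r j) = (\<Sum>j\<in>?V. \<Sum>i\<in>?V. a i j * x i * r j)"
      by (rule sum.swap)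
    also have "\<dots> = (\<Sum>i\<in>?V. \<Sum>j\<in>?V. a i j * r i * x j)"
      using sym by (intro sum.cong refl) (auto simp: mult_ac)
    finally have s: "(\<Sum>i\<in>?V. \<Sum>j\<in>?V. a i j * x i * r j) = (\<Sum>i\<in>?V. \<Sum>j\<in>?V. a i j * r i * x j)" .
    have "quad_form n a (\<lambda>i. x i + t * r i) = (\<Sum>i\<in>?V. \<Sum>j\<in>?V. a i j * x i * x j
       + t * (a i j * x i * r j) + t * (a i j * r i * x j) + t^2 * (a i j * r i * r j))"
      unfolding quad_form_def by (intro sum.cong refl) (simp add: algebra_simps power2_eq_square)
    also have "\<dots> = quad_form n a x + t * (\<Sum>i\<in>?V. \<Sum>j\<in>?V. a i j * x i * r j)
        + t * (\<Sum>i\<in>?V. \<Sum>j\<in>?V. a i j * r i * x j) + t^2 * quad_form n a r"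
      by (simp add: quad_form_def sum.distrib sum_distrib_left)
    also have "\<dots> = quad_form n a x + 2 * t * (\<Sum>i\<in>?V. \<Sum>j\<in>?V. a i j * r i * x j) + t^2 * quad_form n a r"
      unfolding s by simp
    also have "(\<Sum>i\<in>?V. \<Sum>j\<in>?V. a i j * r i * x j) = (\<Sum>i\<in>?V. r i * (\<Sum>j\<in>?V. a i j * x j))"
      by (simp add: sum_distrib_left mult_ac)
    finally show ?thesis .
  qed
  have nn: "sqnorm ?V (\<lambda>i. x i + t * r i) = sqnorm ?V x + 2 * t * (\<Sum>i\<in>?V. r i * x i) + t^2 * sqnorm ?V r" for t
    by (simp add: sqnorm_def sum.distrib sum_distrib_left power2_sum algebra_simps power_mult_distrib)
  have Bt: "B (\<lambda>i. x i + t * r i) = 2 * t * sqnorm ?V r + t^2 * B r" for t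
  proof -
    have "sqnorm ?V r = (\<Sum>i\<in>?V. M * (r i * x i) - r i * (\<Sum>j\<in>?V. a i j * x j))"
      unfolding sqnorm_def
    proof (intro sum.cong refl)
      fix i
      have "(r i)^2 = r i * (M * x i - (\<Sum>j\<in>?V. a i j * x j))"
        by (simp only: power2_eq_square) (simp add: r_def)
      thus "(r i)^2 = M * (r i * x i) - r i * (\<Sum>j\<in>?V. a i j * x j)"
        by (simp only: right_diff_distrib mult_ac)
    qed
    also have "\<dots> = M * (\<Sum>i\<in>?V. r i * x i) - (\<Sum>i\<in>?V. r i * (\<Sum>j\<in>?V. a i j * x j))"
      by (simp only: sum_subtractf sum_distrib_left[of M])
    finally have "sqnorm ?V r = M * (\<Sum>i\<in>?V. r i * x i) - (\<Sum>i\<in>?V. r i * (\<Sum>j\<in>?V. a i j * x j))" .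
    moreover define P where "P = (\<Sum>i\<in>?V. r i * x i)"
    moreover define R where "R = (\<Sum>i\<in>?V. r i * (\<Sum>j\<in>?V. a i j * x j))"
    ultimately have Nr: "sqnorm ?V r = M * P - R" by simp
    have "B (\<lambda>i. x i + t * r i) = B x + 2 * t * (M * P - R) + t^2 * B r"
      unfolding B_def q nn P_def[symmetric] R_def[symmetric] by (simp add: algebra_simps)
    thus ?thesis using Bx Nr by simp
  qed
  have "sqnorm ?V r = 0"
  proof (rule ccontr)
    assume "sqnorm ?V r \<noteq> 0"
    hence N: "sqnorm ?V r > 0" using sqnorm_nonneg[of ?V r] by linarith
    define s where "s = sqnorm ?V r / (B r + 1)"
    have s: "s > 0" using N Bge[of r] by (simp add: s_def)
    have "0 \<le> 2 * (-s) * sqnorm ?V r + (-s)^2 * B r" using Bge Bt by metis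
    hence "s * (2 * sqnorm ?V r) \<le> s * (s * B r)" by (simp add: power2_eq_square algebra_simps)
    hence "2 * sqnorm ?V r \<le> s * B r" using s by simp
    also have "s * B r \<le> s * (B r + 1)" using s by simp
    also have "\<dots> = sqnorm ?V r" using Bge[of r] by (simp add: s_def)
    finally show False using N by simp
  qed
  hence "r i = 0" using \<open>i < n\<close> sqnorm_eq_0[of ?V r i] by simp
  thus ?thesis by (simp add: r_def)
qed

lemma real_symmetric_char_poly_splits:
  fixes A :: "real mat"
  assumes A: "A \<in> carrier_mat n n"
    and sym: "\<And>i j. i < n \<Longrightarrow> j < n \<Longrightarrow> A $$ (i,j) = A $$ (j,i)"
  shows "\<exists>as. char_poly A = (\<Prod>a\<leftarrow>as. [:- a, 1:]) \<and> length as = n"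
proof -
  let ?B = "map_mat complex_of_real A"
  let ?V = "{0..<n}"
  have B: "?B \<in> carrier_mat n n" using A by simp
  obtain cs where cs: "char_poly ?B = (\<Prod>a\<leftarrow>cs. [:- a, 1:])" "length cs = n"
    using char_poly_factorized[OF B] by blast
  have real: "c \<in> \<real>" if "c \<in> set cs" for c
  proof -
    have "poly (char_poly ?B) c = 0"
      using that unfolding cs(1) by (auto simp: poly_prod_list prod_list_zero_iff)
    hence "eigenvalue ?B c" using eigenvalue_root_char_poly[OF B] by simp
    then obtain v where v: "v \<in> carrier_vec n" "v \<noteq> 0\<^sub>v n" "?B *\<^sub>v v = c \<cdot>\<^sub>v v"
      using B unfolding eigenvalue_def eigenvector_def by auto
    have row: "(\<Sum>j\<in>?V. complex_of_real (A $$ (i,j)) * vec_index v j) = c * vec_index v i" if "i < n" for i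
    proof -
      have "vec_index (?B *\<^sub>v v) i = (\<Sum>j\<in>?V. complex_of_real (A $$ (i,j)) * vec_index v j)"
        using A v(1) that by (simp add: scalar_prod_def)
      thus ?thesis using v that by simp
    qed
    define T where "T = (\<Sum>i\<in>?V. \<Sum>j\<in>?V. complex_of_real (A $$ (i,j)) * vec_index v j * cnj (vec_index v i))"
    define N where "N = (\<Sum>i\<in>?V. (cmod (vec_index v i))^2)"
    have "T = (\<Sum>i\<in>?V. c * vec_index v i * cnj (vec_index v i))"
      unfolding T_def by (intro sum.cong refl) (simp add: row sum_distrib_right[symmetric])
    also have "\<dots> = c * of_real N"
      by (simp add: N_def sum_distrib_left mult.assoc complex_norm_square del: of_real_power)
    finally have TN: "T = c * of_real N" .
    have "cnj T = (\<Sum>i\<in>?V. \<Sum>j\<in>?V. complex_of_real (A $$ (i,j)) * cnj (vec_index v j) * vec_index v i)"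
      by (simp add: T_def)
    also have "\<dots> = (\<Sum>j\<in>?V. \<Sum>i\<in>?V. complex_of_real (A $$ (i,j)) * cnj (vec_index v j) * vec_index v i)"
      by (rule sum.swap)
    also have "\<dots> = T"
      unfolding T_def using sym by (intro sum.cong refl) (auto simp: mult_ac)
    finally have "cnj T = T" .
    hence eq: "cnj c * of_real N = c * of_real N" using TN by simp
    obtain i where i: "i < n" "vec_index v i \<noteq> 0" using v by (metis eq_vecI index_zero_vec carrier_vecD)
    have "0 < (cmod (vec_index v i))^2" using i by simp
    also have "\<dots> \<le> N" unfolding N_def using i by (intro member_le_sum) auto
    finally have "cnj c = c" using eq by simp
    thus ?thesis using Reals_cnj_iff by blast
  qed
  interpret of_real_poly: map_poly_inj_comm_ring_hom complex_of_real ..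
  define as where "as = map Re cs"
  have cs_as: "cs = map complex_of_real as"
    unfolding as_def using real by (auto simp: list_eq_iff_nth_eq)
  have "map_poly complex_of_real (char_poly A) = char_poly ?B"
    by (rule of_real_hom.char_poly_hom[OF A, symmetric])
  also have "\<dots> = map_poly complex_of_real (\<Prod>a\<leftarrow>as. [:- a, 1:])"
    unfolding cs(1) cs_as
  proof (induction as)
    case (Cons a as)
    have "map_poly complex_of_real ([:- a, 1:] * (\<Prod>a\<leftarrow>as. [:- a, 1:])) =
        [:- complex_of_real a, 1:] * map_poly complex_of_real (\<Prod>a\<leftarrow>as. [:- a, 1:])"
      by (subst of_real_poly.hom_mult) simp
    thus ?case using Cons by simp
  qed simp
  finally have "char_poly A = (\<Prod>a\<leftarrow>as. [:- a, 1:])"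
    by (rule of_real_poly.injectivity)
  moreover have "length as = n" using cs(2) by (simp add: as_def)
  ultimately show ?thesis by blast
qed

lemma real_symmetric_spectrum:
  fixes A :: "real mat"
  assumes A: "A \<in> carrier_mat n n" and "n > 0"
    and sym: "\<And>i j. i < n \<Longrightarrow> j < n \<Longrightarrow> A $$ (i,j) = A $$ (j,i)"
  defines "L \<equiv> rev (sorted_list_of_multiset (proots (char_poly A)))"
    and "q \<equiv> quad_form n (\<lambda>i j. A $$ (i,j))"
  shows "\<exists>x. sqnorm {0..<n} x = 1 \<and> q x = L ! 0"
    and "q y \<le> L ! 0 * sqnorm {0..<n} y"
    and "\<exists>x. sqnorm {0..<n} x = 1 \<and> q x = L ! (n - 1)"
    and "L ! (n - 1) * sqnorm {0..<n} y \<le> q y"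
proof -
  let ?V = "{0..<n}"
  obtain as where as: "char_poly A = (\<Prod>a\<leftarrow>as. [:- a, 1:])" "length as = n"
    using real_symmetric_char_poly_splits[OF A sym] by blast
  have "proots (\<Prod>a\<leftarrow>as. [:- a, 1:]) = mset as"
  proof (induction as)
    case (Cons a as)
    have "(\<Prod>a\<leftarrow>as. [:- a, 1:]) \<noteq> 0" by (auto simp: prod_list_zero_iff)
    hence "proots ([:- a, 1:] * (\<Prod>a\<leftarrow>as. [:- a, 1:])) = {#a#} + mset as"
      using Cons by (subst proots_mult) auto
    thus ?case by simp
  qed simp
  hence L: "L = rev (sort as)" unfolding L_def as(1) by simp
  have lenL: "length L = n" and setL: "set L = set as" using L as by auto
  have L0: "L ! 0 \<in> set as" and Ln: "L ! (n-1) \<in> set as"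
    using lenL setL \<open>n > 0\<close> nth_mem[of 0 L] nth_mem[of "n-1" L] by auto
  have "sorted (rev L)" using L by simp
  hence mono: "L ! j \<le> L ! i" if "i \<le> j" "j < n" for i j
    using that lenL by (metis sorted_rev_nth_mono)
  have "l \<le> L ! 0 \<and> L ! (n-1) \<le> l" if l: "l \<in> set as" for l
  proof -
    obtain k where k: "k < n" "l = L ! k" using l setL lenL by (metis in_set_conv_nth)
    thus ?thesis using mono[of 0 k] mono[of k "n-1"] by simp
  qed
  hence max: "l \<le> L ! 0" and min: "L ! (n-1) \<le> l" if "l \<in> set as" for l using that by auto
  have root: "l \<in> set as \<longleftrightarrow> eigenvalue A l" for l
    unfolding eigenvalue_root_char_poly[OF A] as(1) by (auto simp: poly_prod_list prod_list_zero_iff)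
  have mv: "vec_index (A *\<^sub>v v) i = (\<Sum>j\<in>?V. A $$ (i,j) * vec_index v j)"
    if "i < n" "v \<in> carrier_vec n" for i v
    using A that by (simp add: scalar_prod_def)
  have attained: "\<exists>x. sqnorm ?V x = 1 \<and> q x = l" if l: "l \<in> set as" for l
  proof -
    obtain v where v: "v \<in> carrier_vec n" "v \<noteq> 0\<^sub>v n" "A *\<^sub>v v = l \<cdot>\<^sub>v v"
      using l A unfolding root eigenvalue_def eigenvector_def by auto
    define f where "f = vec_index v"
    have row: "(\<Sum>j\<in>?V. A $$ (i,j) * f j) = l * f i" if "i < n" for i
      using mv[OF that v(1)] v that by (simp add: f_def)
    obtain i where i: "i < n" "f i \<noteq> 0" using v unfolding f_def by (metis eq_vecI index_zero_vec carrier_vecD)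
    hence "sqnorm ?V f \<noteq> 0" using sqnorm_eq_0[of ?V f i] by auto
    hence N: "sqnorm ?V f > 0" using sqnorm_nonneg[of ?V f] by linarith
    define x where "x = (\<lambda>i. f i / sqrt (sqnorm ?V f))"
    have "sqnorm ?V x = 1"
      using N by (simp add: x_def sqnorm_def power_divide sum_nonneg flip: sum_divide_distrib)
    moreover have rowx: "(\<Sum>j\<in>?V. A $$ (i,j) * x j) = l * x i" if "i < n" for i
      using row[OF that] by (simp add: x_def flip: sum_divide_distrib)
    have "q x = (\<Sum>i\<in>?V. x i * (l * x i))"
      unfolding q_def quad_form_def
    proof (intro sum.cong refl)
      fix i assume i: "i \<in> ?V"
      have "(\<Sum>j\<in>?V. A $$ (i,j) * x i * x j) = x i * (\<Sum>j\<in>?V. A $$ (i,j) * x j)"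
        by (simp add: sum_distrib_left mult_ac)
      thus "(\<Sum>j\<in>?V. A $$ (i,j) * x i * x j) = x i * (l * x i)"
        using rowx[of i] i by simp
    qed
    hence "q x = l * sqnorm ?V x" by (simp add: sqnorm_def sum_distrib_left power2_eq_square mult_ac)
    ultimately show ?thesis by auto
  qed
  have eig: "l \<in> set as"
    if "sqnorm ?V x = 1" "\<And>i. i < n \<Longrightarrow> (\<Sum>j\<in>?V. A $$ (i,j) * x j) = l * x i" for x l
  proof -
    have "A *\<^sub>v vec n x = l \<cdot>\<^sub>v vec n x"
      using A that(2) by (intro eq_vecI) (auto simp: scalar_prod_def)
    moreover have "vec n x \<noteq> 0\<^sub>v n"
    proof
      assume "vec n x = 0\<^sub>v n"
      hence "\<And>i. i < n \<Longrightarrow> x i = 0" by (metis index_vec index_zero_vec(1))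
      hence "sqnorm ?V x = 0" by (simp add: sqnorm_def)
      thus False using that(1) by simp
    qed
    ultimately show ?thesis unfolding root eigenvalue_def eigenvector_def using A by (auto intro!: exI[of _ "vec n x"])
  qed
  show "\<exists>x. sqnorm ?V x = 1 \<and> q x = L ! 0" "\<exists>x. sqnorm ?V x = 1 \<and> q x = L ! (n-1)"
    using attained L0 Ln by blast+
  obtain x where x: "sqnorm ?V x = 1" "\<And>y. q y \<le> q x * sqnorm ?V y"
    using quad_form_max_exists[OF \<open>n > 0\<close>, of "\<lambda>i j. A $$ (i,j)"] unfolding q_def by blast
  have "q x \<in> set as"
    by (rule eig[OF x(1)], rule quad_form_max_eigen[where a = "\<lambda>i j. A $$ (i,j)"])
       (use x sym in \<open>auto simp: q_def\<close>)
  hence "q x \<le> L ! 0" by (rule max)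
  thus "q y \<le> L ! 0 * sqnorm ?V y" using x(2)[of y] mult_right_mono[of "q x" "L!0" "sqnorm ?V y"] by simp
  have neg: "quad_form n (\<lambda>i j. - A $$ (i,j)) = (\<lambda>y. - q y)"
    by (simp add: quad_form_def q_def fun_eq_iff sum_negf)
  obtain z where z: "sqnorm ?V z = 1" "\<And>y. - q y \<le> - q z * sqnorm ?V y"
    using quad_form_max_exists[OF \<open>n > 0\<close>, of "\<lambda>i j. - A $$ (i,j)"] unfolding neg by blast
  have "q z \<in> set as"
  proof (rule eig[OF z(1)])
    fix i assume "i < n"
    have "(\<Sum>j\<in>?V. - A $$ (i,j) * z j) = (- q z) * z i"
      by (rule quad_form_max_eigen[where a = "\<lambda>i j. - A $$ (i,j)"])
         (use z sym \<open>i < n\<close> in \<open>auto simp: neg\<close>)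
    thus "(\<Sum>j\<in>?V. A $$ (i,j) * z j) = q z * z i" by (simp add: sum_negf)
  qed
  hence "L ! (n-1) \<le> q z" by (rule min)
  thus "L ! (n-1) * sqnorm ?V y \<le> q y"
    using z(2)[of y] mult_right_mono[of "L!(n-1)" "q z" "sqnorm ?V y"] by simp
qed

section \<open>The quadratic form of the signless Laplacian\<close>

definition edge_form :: "('a \<times> 'a) set \<Rightarrow> ('a \<Rightarrow> real) \<Rightarrow> real" where
  "edge_form E x = (\<Sum>(u, v)\<in>E. (x u + x v)\<^sup>2) / 2"

lemma edge_form_nonneg: "0 \<le> edge_form E x"
  by (auto simp: edge_form_def intro!: divide_nonneg_nonneg sum_nonneg)

definition complement_arcs :: "'a set \<Rightarrow> ('a \<times> 'a) set \<Rightarrow> ('a \<times> 'a) set" where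
  "complement_arcs V E = {(u, v). u \<in> V \<and> v \<in> V \<and> u \<noteq> v} - E"

definition delete_vertex :: "('a \<times> 'a) set \<Rightarrow> 'a \<Rightarrow> ('a \<times> 'a) set" where
  "delete_vertex E w = {(u, v) \<in> E. u \<noteq> w \<and> v \<noteq> w}"

lemma weighted_am_gm:
  fixes a b p q :: real
  assumes "0 < a" "0 < b"
  shows "2 * (p * q) \<le> p\<^sup>2 * (b / a) + q\<^sup>2 * (a / b)"
proof -
  have "0 \<le> (b * p - a * q)\<^sup>2 / (a * b)" using assms by simp
  also have "\<dots> = p\<^sup>2 * (b / a) + q\<^sup>2 * (a / b) - 2 * (p * q)"
    using assms by (simp add: field_simps power2_eq_square)
  finally show ?thesis by simp
qed

locale simple_graph =
  fixes V :: "'a set" and E :: "('a \<times> 'a) set"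
  assumes finite_V [simp, intro]: "finite V" and E_sub: "E \<subseteq> V \<times> V"
    and E_sym: "(u, v) \<in> E \<Longrightarrow> (v, u) \<in> E" and E_irrefl: "(u, u) \<notin> E"
begin

abbreviation degree :: "'a \<Rightarrow> nat" where "degree u \<equiv> card (E `` {u})"

lemma finite_E [simp, intro]: "finite E"
  using E_sub finite_subset by blast

lemma nbrs_subset: "E `` {u} \<subseteq> V - {u}"
  using E_sub E_irrefl by auto

lemma finite_nbrs [simp, intro]: "finite (E `` {u})"
  using nbrs_subset finite_subset by (metis finite_Diff finite_V)

lemma sum_arcs: "(\<Sum>(u, v)\<in>E. f u v) = (\<Sum>u\<in>V. \<Sum>v\<in>E `` {u}. f u v)"
proof -
  have "E = Sigma V (\<lambda>u. E `` {u})" using E_sub by auto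
  thus ?thesis by (subst (1) \<open>E = _\<close>, subst sum.Sigma) auto
qed

lemma sum_arcs_swap: "(\<Sum>(u, v)\<in>E. f v u) = (\<Sum>(u, v)\<in>E. f u v)"
  by (rule sum.reindex_bij_witness[of _ prod.swap prod.swap]) (auto intro: E_sym)

lemma card_arcs: "card E = (\<Sum>u\<in>V. degree u)"
  using sum_arcs[of "\<lambda>_ _. 1::nat"] by simp

lemma degree_le: "degree u \<le> card V - 1" if "u \<in> V"
  using card_mono[OF _ nbrs_subset[of u]] that by simp

lemma edge_form_expand:
  "edge_form E x = (\<Sum>u\<in>V. real (degree u) * (x u)\<^sup>2) + (\<Sum>(u, v)\<in>E. x u * x v)"
proof -
  have "(\<Sum>(u, v)\<in>E. (x u + x v)\<^sup>2) = (\<Sum>(u, v)\<in>E. (x u)\<^sup>2) + (\<Sum>(u, v)\<in>E. (x v)\<^sup>2) + (\<Sum>(u, v)\<in>E. 2 * (x u * x v))"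
    by (simp add: power2_sum case_prod_unfold sum.distrib mult.assoc)
  also have "(\<Sum>(u, v)\<in>E. (x v)\<^sup>2) = (\<Sum>(u, v)\<in>E. (x u)\<^sup>2)" by (rule sum_arcs_swap)
  also have "(\<Sum>(u, v)\<in>E. 2 * (x u * x v)) = 2 * (\<Sum>(u, v)\<in>E. x u * x v)"
    by (simp add: case_prod_unfold sum_distrib_left)
  finally show ?thesis by (simp add: edge_form_def sum_arcs[of "\<lambda>u v. (x u)\<^sup>2"])
qed

lemma edge_form_le_max_degree:
  assumes "\<And>u. u \<in> V \<Longrightarrow> degree u \<le> D"
  shows "edge_form E x \<le> (real D + sqrt (card E)) * sqnorm V x"
proof -
  have "(\<Sum>(u, v)\<in>E. x u * x v)\<^sup>2 \<le> (\<Sum>p\<in>E. 1\<^sup>2) * (\<Sum>p\<in>E. (x (fst p) * x (snd p))\<^sup>2)"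
    using Cauchy_Schwarz_ineq_sum[of "\<lambda>_. 1" "\<lambda>p. x (fst p) * x (snd p)" E]
    by (simp add: case_prod_unfold)
  also have "(\<Sum>p\<in>E. (x (fst p) * x (snd p))\<^sup>2) \<le> (\<Sum>p\<in>V \<times> V. (x (fst p) * x (snd p))\<^sup>2)"
    using E_sub by (intro sum_mono2) auto
  also have "\<dots> = (sqnorm V x)\<^sup>2"
    unfolding sqnorm_def power2_eq_square[of "sum _ _"] sum_product sum.cartesian_product
    by (simp add: case_prod_unfold power_mult_distrib)
  finally have "(\<Sum>(u, v)\<in>E. x u * x v)\<^sup>2 \<le> card E * (sqnorm V x)\<^sup>2" by (simp add: mult_left_mono)
  hence "sqrt ((\<Sum>(u, v)\<in>E. x u * x v)\<^sup>2) \<le> sqrt (card E * (sqnorm V x)\<^sup>2)" by (rule real_sqrt_le_mono)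
  hence "(\<Sum>(u, v)\<in>E. x u * x v) \<le> sqrt (card E) * sqnorm V x" by (simp add: real_sqrt_mult)
  moreover have "(\<Sum>u\<in>V. real (degree u) * (x u)\<^sup>2) \<le> (\<Sum>u\<in>V. real D * (x u)\<^sup>2)"
    using assms by (intro sum_mono mult_right_mono) auto
  ultimately show ?thesis
    by (simp add: edge_form_expand sqnorm_def distrib_right flip: sum_distrib_left)
qed

lemma sum_nbr_degrees_le:
  assumes deg: "\<And>u. u \<in> V \<Longrightarrow> 1 \<le> degree u" and u: "u \<in> V" and n: "card V = n" "n \<ge> 2"
  shows "(\<Sum>v\<in>E `` {u}. real (degree v)) \<le> degree u * (real (card E) / (real n - 1) + n - 2 - degree u)"
proof -
  let ?N = "E `` {u}" and ?d = "real (degree u)" and ?S = "real (card E)"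
  define X where "X = (\<Sum>v\<in>?N. real (degree v))"
  have dn: "?d \<le> real n - 1" using degree_le[OF u] n by linarith
  have "X \<le> (\<Sum>v\<in>?N. real n - 1)"
    unfolding X_def using degree_le nbrs_subset[of u] n by (intro sum_mono) force
  hence X1: "X \<le> ?d * (real n - 1)" by simp
  have sub: "?N \<subseteq> V" "u \<in> V - ?N" using nbrs_subset[of u] u by auto
  have "?S = X + (\<Sum>v\<in>V - ?N. real (degree v))"
    using sum.subset_diff[OF sub(1), of "\<lambda>v. real (degree v)"] by (simp add: X_def card_arcs)
  also have "(\<Sum>v\<in>V - ?N. real (degree v)) = ?d + (\<Sum>v\<in>V - ?N - {u}. real (degree v))"
    using sub by (subst sum.remove[of _ u]) auto
  also have "(\<Sum>v\<in>V - ?N - {u}. real (degree v)) \<ge> (\<Sum>v\<in>V - ?N - {u}. 1)"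
    using deg by (intro sum_mono) force
  also (xtrans) have "(\<Sum>v\<in>V - ?N - {u}. 1::real) = real n - 1 - ?d"
  proof -
    have "card (V - ?N - {u}) = card V - degree u - 1"
      using sub by (simp add: card_Diff_subset)
    thus ?thesis using dn n by simp
  qed
  finally have X2: "X \<le> ?S - (real n - 1)" by simp
  define t where "t = ?d / (real n - 1)"
  have t: "0 \<le> t" "t \<le> 1" and d: "?d = t * (real n - 1)" using dn n by (auto simp: t_def)
  have "X = t * X + (1 - t) * X" by (simp add: algebra_simps)
  also have "\<dots> \<le> t * (?S - (real n - 1)) + (1 - t) * (?d * (real n - 1))"
    using t X1 X2 by (intro add_mono mult_left_mono) auto
  also have "\<dots> = t * ?S - ?d + ?d * (real n - 1) - ?d * ?d"
    unfolding d by (simp add: algebra_simps)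
  also have "t * ?S = ?d * (?S / (real n - 1))" by (simp add: t_def)
  finally show ?thesis using n by (simp add: X_def of_nat_diff algebra_simps)
qed

lemma edge_form_le_card_arcs:
  assumes deg: "\<And>u. u \<in> V \<Longrightarrow> 1 \<le> degree u" and n: "card V = n" "n \<ge> 2"
  shows "edge_form E x \<le> (real (card E) / (real n - 1) + n - 2) * sqnorm V x"
proof -
  let ?d = "\<lambda>u. real (degree u)"
  \<comment> \<open>AM-GM with the degrees as weights\<close>
  have "2 * (x u * x v) \<le> (x u)\<^sup>2 * (?d v / ?d u) + (x v)\<^sup>2 * (?d u / ?d v)" if "(u, v) \<in> E" for u v
  proof -
    have p: "0 < ?d u" "0 < ?d v" using that E_sub deg[of u] deg[of v] by force+
    show ?thesis using p by (rule weighted_am_gm)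
  qed
  hence "(\<Sum>(u, v)\<in>E. 2 * (x u * x v)) \<le> (\<Sum>(u, v)\<in>E. (x u)\<^sup>2 * (?d v / ?d u) + (x v)\<^sup>2 * (?d u / ?d v))"
    by (intro sum_mono) auto
  also have "\<dots> = (\<Sum>(u, v)\<in>E. (x u)\<^sup>2 * (?d v / ?d u)) + (\<Sum>(u, v)\<in>E. (x v)\<^sup>2 * (?d u / ?d v))"
    by (simp add: case_prod_unfold sum.distrib)
  also have "(\<Sum>(u, v)\<in>E. (x v)\<^sup>2 * (?d u / ?d v)) = (\<Sum>(u, v)\<in>E. (x u)\<^sup>2 * (?d v / ?d u))"
    by (rule sum_arcs_swap)
  finally have "(\<Sum>(u, v)\<in>E. x u * x v) \<le> (\<Sum>(u, v)\<in>E. (x u)\<^sup>2 * (?d v / ?d u))"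
    by (simp add: case_prod_unfold flip: sum_distrib_left)
  also have "\<dots> = (\<Sum>u\<in>V. (x u)\<^sup>2 / ?d u * (\<Sum>v\<in>E `` {u}. ?d v))"
    by (simp add: sum_arcs sum_distrib_left)
  also have "\<dots> \<le> (\<Sum>u\<in>V. (x u)\<^sup>2 / ?d u * (?d u * (real (card E) / (real n - 1) + n - 2 - ?d u)))"
    using sum_nbr_degrees_le[OF deg _ n] by (intro sum_mono mult_left_mono) auto
  also have "\<dots> = (\<Sum>u\<in>V. (real (card E) / (real n - 1) + n - 2) * (x u)\<^sup>2 - ?d u * (x u)\<^sup>2)"
  proof (intro sum.cong refl)
    fix u assume "u \<in> V"
    hence "?d u \<noteq> 0" using deg[of u] by (cases "degree u = 0") linarith+
    thus "(x u)\<^sup>2 / ?d u * (?d u * (real (card E) / (real n - 1) + n - 2 - ?d u))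
        = (real (card E) / (real n - 1) + n - 2) * (x u)\<^sup>2 - ?d u * (x u)\<^sup>2"
      by (simp add: left_diff_distrib right_diff_distrib mult_ac)
  qed
  finally show ?thesis
    by (simp add: edge_form_expand sqnorm_def sum_subtractf flip: sum_distrib_left)
qed

lemma twice_degree_le_card_arcs: "2 * degree u \<le> card E"
proof -
  have "card ((\<lambda>v. (u, v)) ` (E `` {u}) \<union> (\<lambda>v. (v, u)) ` (E `` {u})) = degree u + degree u"
    using E_irrefl by (subst card_Un_disjoint) (auto simp: card_image inj_on_def)
  moreover have "(\<lambda>v. (u, v)) ` (E `` {u}) \<union> (\<lambda>v. (v, u)) ` (E `` {u}) \<subseteq> E" using E_sym by auto
  ultimately show ?thesis using card_mono[OF finite_E] by (metis mult_2)
qed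

lemma simple_graph_complement: "simple_graph V (complement_arcs V E)"
  by unfold_locales (auto simp: complement_arcs_def intro: E_sym)

lemma complement_degree:
  assumes "u \<in> V"
  shows "degree u + card (complement_arcs V E `` {u}) = card V - 1"
proof -
  have "degree u + card (complement_arcs V E `` {u}) = card (E `` {u} \<union> complement_arcs V E `` {u})"
    using simple_graph.finite_nbrs[OF simple_graph_complement]
    by (intro card_Un_disjoint[symmetric]) (auto simp: complement_arcs_def)
  also have "E `` {u} \<union> complement_arcs V E `` {u} = V - {u}"
    using assms E_sub E_irrefl by (auto simp: complement_arcs_def)
  finally show ?thesis using assms by simp
qed

lemma card_complement: "card E + card (complement_arcs V E) = card V * (card V - 1)"
  using complement_degree
  by (simp add: card_arcs simple_graph.card_arcs[OF simple_graph_complement] flip: sum.distrib)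

lemma edge_form_complement:
  "edge_form E x + edge_form (complement_arcs V E) x = (real (card V) - 2) * sqnorm V x + (\<Sum>u\<in>V. x u)\<^sup>2"
proof -
  let ?f = "\<lambda>(u, v). (x u + x v)\<^sup>2"
  let ?I = "(\<lambda>u. (u, u)) ` V"
  have "V \<times> V = (E \<union> complement_arcs V E) \<union> ?I"
    using E_sub by (auto simp: complement_arcs_def)
  hence "sum ?f (V \<times> V) = sum ?f ((E \<union> complement_arcs V E) \<union> ?I)" by simp
  also have "\<dots> = sum ?f (E \<union> complement_arcs V E) + sum ?f ?I"
    using E_irrefl simple_graph.finite_E[OF simple_graph_complement]
    by (intro sum.union_disjoint) (auto simp: complement_arcs_def)
  also have "sum ?f (E \<union> complement_arcs V E) = sum ?f E + sum ?f (complement_arcs V E)"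
    using simple_graph.finite_E[OF simple_graph_complement]
    by (intro sum.union_disjoint) (auto simp: complement_arcs_def)
  also have "sum ?f ?I = 4 * sqnorm V x"
    by (subst sum.reindex) (auto simp: inj_on_def sqnorm_def sum_distrib_left power2_eq_square algebra_simps)
  finally have *: "sum ?f (V \<times> V) = 2 * (edge_form E x + edge_form (complement_arcs V E) x) + 4 * sqnorm V x"
    by (simp add: edge_form_def)
  have "sum ?f (V \<times> V) = (\<Sum>u\<in>V. \<Sum>v\<in>V. (x u)\<^sup>2 + (x v)\<^sup>2 + 2 * x u * x v)"
    by (simp add: sum.cartesian_product power2_sum)
  also have "\<dots> = 2 * real (card V) * sqnorm V x + 2 * (\<Sum>u\<in>V. x u)\<^sup>2"
    by (simp add: sum.distrib sqnorm_def power2_eq_square[of "sum _ _"] sum_product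
        sum_distrib_left sum_distrib_right mult_ac)
  finally show ?thesis using * by (simp add: algebra_simps)
qed

lemma simple_graph_delete_vertex: "simple_graph (V - {w}) (delete_vertex E w)"
  using E_sub E_sym E_irrefl by unfold_locales (auto simp: delete_vertex_def)

lemma sum_delete_vertex:
  "sum f E = sum f (delete_vertex E w) + (\<Sum>v\<in>E `` {w}. f (w, v) + f (v, w))"
proof -
  let ?A = "(\<lambda>v. (w, v)) ` (E `` {w})" and ?B = "(\<lambda>v. (v, w)) ` (E `` {w})"
  have "E = delete_vertex E w \<union> (?A \<union> ?B)" using E_sym by (auto simp: delete_vertex_def)
  hence "sum f E = sum f (delete_vertex E w \<union> (?A \<union> ?B))" by simp
  also have "\<dots> = sum f (delete_vertex E w) + sum f (?A \<union> ?B)"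
    using simple_graph.finite_E[OF simple_graph_delete_vertex]
    by (intro sum.union_disjoint) (auto simp: delete_vertex_def)
  also have "sum f (?A \<union> ?B) = sum f ?A + sum f ?B"
    using E_irrefl by (intro sum.union_disjoint) auto
  finally show ?thesis by (simp add: sum.reindex inj_on_def sum.distrib)
qed

lemma edge_form_delete_vertex:
  "edge_form E x = edge_form (delete_vertex E w) x + (\<Sum>v\<in>E `` {w}. (x w + x v)\<^sup>2)"
  using sum_delete_vertex[of "\<lambda>(u, v). (x u + x v)\<^sup>2" w]
  by (simp add: edge_form_def add.commute add_divide_distrib flip: mult_2 sum_distrib_left)

lemma card_delete_vertex: "card E = card (delete_vertex E w) + 2 * degree w"
  using sum_delete_vertex[of "\<lambda>_. 1::nat" w] by simp

lemma delete_vertex_complement: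
  "complement_arcs (V - {w}) (delete_vertex E w) = delete_vertex (complement_arcs V E) w"
  by (auto simp: complement_arcs_def delete_vertex_def)

theorem large_gap_imp_pendant:
  fixes x y :: "'a \<Rightarrow> real" and q1 qn :: real
  assumes n: "card V = n" "n \<ge> 10000" and deg: "\<And>u. u \<in> V \<Longrightarrow> 1 \<le> degree u"
    and x: "sqnorm V x = 1" "edge_form E x = q1" "\<And>u. u \<in> V \<Longrightarrow> 0 \<le> x u"
    and eigen: "\<And>u. u \<in> V \<Longrightarrow> (\<Sum>v\<in>E `` {u}. x v) = (q1 - degree u) * x u"
    and y: "sqnorm V y = 1" "edge_form E y = qn"
    and qn_le: "\<And>z. qn * sqnorm V z \<le> edge_form E z"
    and gap: "q1 - qn \<ge> 2 * real n - 5"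
  shows "\<exists>w\<in>V. \<exists>c. E `` {w} = {c} \<and>
    (\<forall>u\<in>V - {w}. \<forall>v\<in>V - {w}. (y u + y v)\<^sup>2 < (x u + x v)\<^sup>2)"
proof -
  let ?C = "complement_arcs V E"
  interpret C: simple_graph V ?C by (rule simple_graph_complement)
  define m where "m = real (card ?C)"
  have "V \<noteq> {}" using n by auto
  have N: "real n \<ge> 10000" using n by simp
  have "real (card E) + m = real n * (real n - 1)"
    using arg_cong[OF card_complement, of real] n by (simp add: m_def of_nat_diff)
  hence "real (card E) = (real n - m / (real n - 1)) * (real n - 1)"
    using N by (simp add: left_diff_distrib)
  hence "real (card E) / (real n - 1) = real n - m / (real n - 1)" using N by simp
  moreover have "q1 \<le> real (card E) / (real n - 1) + n - 2"
    using edge_form_le_card_arcs[OF deg n(1), of x] n x by (simp add: of_nat_diff)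
  ultimately have q1_le: "q1 \<le> 2 * real n - 2 - m / (real n - 1)" by simp
  hence m_qn: "m / (real n - 1) + qn \<le> 3" using gap by simp
  have "qn \<ge> 0" using y(2) edge_form_nonneg[of E y] by simp
  hence "m / (real n - 1) \<le> 3" using m_qn by simp
  hence m: "m \<le> 3 * (real n - 1)" using N by (simp add: divide_simps)
  have sqrt_le: "sqrt t \<le> real n / 50" if "t \<le> 3 * real n" for t
  proof (rule real_le_lsqrt)
    have "3 * real n \<le> real n * (real n / 2500)" using N by simp
    thus "t \<le> (real n / 50)\<^sup>2" using that by (simp add: power2_eq_square)
  qed simp
  have sqrt_m: "sqrt m \<le> real n / 50" using m by (intro sqrt_le) simp
  have "Max (C.degree ` V) \<in> C.degree ` V" using \<open>V \<noteq> {}\<close> by (intro Max_in) auto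
  then obtain w where w: "w \<in> V" "Max (C.degree ` V) = C.degree w" by auto
  have w_max: "C.degree u \<le> C.degree w" if "u \<in> V" for u
    using that unfolding w(2)[symmetric] by (intro Max_ge) auto
  define d where "d = real (C.degree w)"
  have "edge_form ?C y \<le> d + sqrt m"
    using C.edge_form_le_max_degree[OF w_max, of y] y by (simp add: d_def m_def)
  moreover have "edge_form E y + edge_form ?C y \<ge> real n - 2"
    using edge_form_complement[of y] y n by simp
  moreover have "qn \<le> 3" using m_qn \<open>qn \<ge> 0\<close> N
    by (smt (verit) divide_nonneg_nonneg m_def of_nat_0_le_iff)
  ultimately have d: "d \<ge> real n - 5 - real n / 50" using y sqrt_m by simp
  have jd: "real (degree w) + d = real n - 1"
    using arg_cong[OF complement_degree[OF w(1)], of real] n by (simp add: d_def of_nat_diff)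

  let ?V = "V - {w}" and ?E = "delete_vertex E w" and ?C' = "delete_vertex ?C w"
  interpret D: simple_graph ?V ?E by (rule simple_graph_delete_vertex)
  interpret C': simple_graph ?V ?C' by (rule C.simple_graph_delete_vertex)
  define m' where "m' = real (card ?C')"
  have mm': "m = m' + 2 * d" using C.card_delete_vertex[of w] by (simp add: m_def m'_def d_def)
  have m'_le: "m' \<le> 104 / 100 * real n + 10" using mm' m d by simp
  have sqrt_m': "sqrt m' \<le> real n / 50" using m'_le N by (intro sqrt_le) simp
  have deg': "real (C'.degree u) \<le> m' / 2" for u
    using C'.twice_degree_le_card_arcs[of u] unfolding m'_def by linarith
  have rest_ge: "edge_form ?E z \<ge> real n / 4 * sqnorm ?V z" for z
  proof -
    have "edge_form ?C' z \<le> (real (card ?C' div 2) + sqrt m') * sqnorm ?V z"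
      using C'.edge_form_le_max_degree[of "card ?C' div 2" z] C'.twice_degree_le_card_arcs
      by (simp add: m'_def less_eq_div_iff_mult_less_eq mult.commute)
    also have "\<dots> \<le> (m' / 2 + real n / 50) * sqnorm ?V z"
      using sqrt_m' by (intro mult_right_mono add_mono) (auto simp: m'_def)
    finally have "edge_form ?C' z \<le> (m' / 2 + real n / 50) * sqnorm ?V z" .
    moreover have "edge_form ?E z + edge_form ?C' z \<ge> (real n - 3) * sqnorm ?V z"
      using D.edge_form_complement[of z] n w by (simp add: delete_vertex_complement of_nat_diff)
    ultimately have "edge_form ?E z \<ge> (real n - 3 - (m' / 2 + real n / 50)) * sqnorm ?V z"
      by (simp only: left_diff_distrib[of "real n - 3"])
    moreover have "real n - 3 - (m' / 2 + real n / 50) \<ge> real n / 4" using m'_le N by simp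
    ultimately show ?thesis
      using mult_right_mono[of "real n / 4" _ "sqnorm ?V z"] sqnorm_nonneg order_trans by blast
  qed

  define a where "a = \<bar>y w\<bar>"
  define b where "b = sqrt (sqnorm ?V y)"
  define j where "j = real (degree w)"
  have b2: "b\<^sup>2 = sqnorm ?V y" and b0: "b \<ge> 0" by (simp_all add: b_def)
  have ab: "a\<^sup>2 + b\<^sup>2 = 1"
    using y w by (simp add: a_def b2 sqnorm_def sum.remove)
  have a0: "0 \<le> a" by (simp add: a_def)
  have a1: "a \<le> 1" using ab by (metis abs_le_square_iff abs_of_nonneg a0 abs_one le_add_same_cancel1 one_power2 zero_le_power2)
  have block: "qn \<ge> j * a\<^sup>2 - 2 * (a * (sqrt j * b)) + real n / 4 * b\<^sup>2"
  proof -
    define S where "S = (\<Sum>v\<in>E `` {w}. y v)"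
    have "S\<^sup>2 \<le> j * (\<Sum>v\<in>E `` {w}. (y v)\<^sup>2)"
      using Cauchy_Schwarz_ineq_sum[of "\<lambda>_. 1" y "E `` {w}"] by (simp add: S_def j_def)
    also have "\<dots> \<le> j * b\<^sup>2"
      unfolding b2 sqnorm_def using nbrs_subset
      by (intro mult_left_mono sum_mono2) (auto simp: j_def)
    finally have "sqrt (S\<^sup>2) \<le> sqrt (j * b\<^sup>2)" by (rule real_sqrt_le_mono)
    hence "\<bar>S\<bar> \<le> sqrt j * b" using b0 by (simp add: real_sqrt_mult)
    hence "a * \<bar>S\<bar> \<le> a * (sqrt j * b)" using a0 by (rule mult_left_mono)
    moreover have "- (y w * S) \<le> a * \<bar>S\<bar>" unfolding a_def by (metis abs_ge_minus_self abs_mult)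
    ultimately have S: "y w * S \<ge> - (a * (sqrt j * b))" by linarith
    have "(\<Sum>v\<in>E `` {w}. (y w + y v)\<^sup>2) \<ge> (\<Sum>v\<in>E `` {w}. (y w)\<^sup>2 + 2 * (y w * y v))"
      by (intro sum_mono) (simp add: power2_sum)
    also have "(\<Sum>v\<in>E `` {w}. (y w)\<^sup>2 + 2 * (y w * y v)) = j * a\<^sup>2 + 2 * (y w * S)"
      by (simp add: sum.distrib S_def j_def a_def sum_distrib_left)
    finally have "(\<Sum>v\<in>E `` {w}. (y w + y v)\<^sup>2) \<ge> j * a\<^sup>2 + 2 * (y w * S)" .
    thus ?thesis using S rest_ge[of y] y(2) edge_form_delete_vertex[of y w] by (simp add: b2)
  qed

  have "degree w = 1"
  proof (rule ccontr)
    assume "degree w \<noteq> 1"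
    hence "j \<ge> 2" using deg[OF w(1)] by (simp add: j_def)
    have "0 \<le> (sqrt j * a / 2 - 2 * b)\<^sup>2" by simp
    also have "\<dots> = j / 4 * a\<^sup>2 - 2 * (a * (sqrt j * b)) + 4 * b\<^sup>2"
      using \<open>j \<ge> 2\<close> by (simp add: power2_diff power_mult_distrib power_divide)
    also have "\<dots> \<le> (j - 3/2) * a\<^sup>2 - 2 * (a * (sqrt j * b)) + (real n / 4 - 3/2) * b\<^sup>2"
      using \<open>j \<ge> 2\<close> N by (intro add_mono diff_right_mono mult_right_mono) auto
    also have "\<dots> \<le> qn - 3/2 * (a\<^sup>2 + b\<^sup>2)" using block by (simp add: algebra_simps)
    finally have "qn \<ge> 3/2" using ab by simp
    moreover have "m > 3/2 * (real n - 1)" using mm' d N unfolding m'_def by simp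
    hence "m / (real n - 1) > 3/2" using N by (simp add: divide_simps)
    ultimately show False using m_qn by simp
  qed
  then obtain c where c: "E `` {w} = {c}" by (rule card_1_singletonE)
  have j: "j = 1" using \<open>degree w = 1\<close> by (simp add: j_def)

  have "qn \<le> 1"
  proof -
    let ?z = "\<lambda>u. if u = w then 1 else 0 :: real"
    have "sqnorm V ?z = 1" using w by (simp add: sqnorm_def if_distrib[of "\<lambda>x. x\<^sup>2"] cong: if_cong)
    moreover have "edge_form ?E ?z = 0" by (auto simp: edge_form_def delete_vertex_def intro!: sum.neutral)
    moreover have "c \<noteq> w" using c E_irrefl by auto
    ultimately show ?thesis using qn_le[of ?z] edge_form_delete_vertex[of ?z w] c by simp
  qed
  hence "a\<^sup>2 - 2 * (a * b) + real n / 4 * b\<^sup>2 \<le> a\<^sup>2 + b\<^sup>2" using block ab j by simp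
  hence "(real n / 4 - 1) * b\<^sup>2 \<le> 2 * (a * b)" by (simp add: algebra_simps)
  also have "\<dots> \<le> 2 * b" using a1 b0 mult_right_mono[of a 1 b] by simp
  finally have "b * ((real n / 4 - 1) * b) \<le> b * 2" by (simp add: power2_eq_square mult_ac)
  hence "(real n / 4 - 1) * b \<le> 2" using b0 by (cases "b = 0") auto
  moreover have "real n / 5 * b \<le> (real n / 4 - 1) * b" using N b0 by (intro mult_right_mono) auto
  ultimately have nb: "real n * b \<le> 10" by simp

  have "Max (x ` V) \<in> x ` V" using \<open>V \<noteq> {}\<close> by (intro Max_in) auto
  then obtain p where p: "p \<in> V" "Max (x ` V) = x p" by auto
  define M where "M = x p"
  have xM: "x u \<le> M" if "u \<in> V" for u
    using that unfolding M_def p(2)[symmetric] by (intro Max_ge) auto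
  have M0: "M \<ge> 0" using x(3) p by (simp add: M_def)
  have "sqnorm V x \<le> (\<Sum>u\<in>V. M\<^sup>2)"
    unfolding sqnorm_def using xM x(3) by (intro sum_mono power_mono) auto
  hence M2: "real n * M\<^sup>2 \<ge> 1" using x(1) n by simp

  have deg_le: "real (degree u) \<le> real n - 1" if "u \<in> V" for u
    using degree_le[OF that] n by linarith
  have "(real n - 4) * M \<le> (q1 - degree p) * x p"
    unfolding M_def using gap \<open>qn \<ge> 0\<close> deg_le[OF p(1)] x(3)[OF p(1)] by (intro mult_right_mono) auto
  also have "\<dots> = (\<Sum>v\<in>E `` {p}. x v)" using eigen[OF p(1)] by simp
  also have "\<dots> \<le> (\<Sum>v\<in>V. x v)" using x(3) nbrs_subset by (intro sum_mono2) auto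
  finally have sum_x: "(real n - 4) * M \<le> (\<Sum>v\<in>V. x v)" .

  have x_ge: "x u \<ge> M / 5" if u: "u \<in> ?V" for u
  proof -
    have uV: "u \<in> V" using u by simp
    have "?C `` {u} \<subseteq> ?C' `` {u} \<union> {w}" using u by (auto simp: delete_vertex_def)
    hence "C.degree u \<le> card (?C' `` {u} \<union> {w})" by (intro card_mono) auto
    also have "\<dots> \<le> C'.degree u + 1" using card_Un_le[of "?C' `` {u}" "{w}"] by simp
    finally have "real (C.degree u) \<le> m' / 2 + 1" using deg'[of u] by linarith
    moreover have "real (card (V - E `` {u})) = real (C.degree u) + 1"
      using complement_degree[OF uV] nbrs_subset[of u] n by (subst card_Diff_subset) auto
    ultimately have cd: "real (card (V - E `` {u})) \<le> m' / 2 + 2" by simp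
    have "(\<Sum>v\<in>V - E `` {u}. x v) \<le> (\<Sum>v\<in>V - E `` {u}. M)" using xM by (intro sum_mono) auto
    also have "\<dots> \<le> (m' / 2 + 2) * M" using cd M0 by (simp add: mult_right_mono)
    finally have "(\<Sum>v\<in>V - E `` {u}. x v) \<le> (m' / 2 + 2) * M" .
    moreover have "(\<Sum>v\<in>V. x v) = (\<Sum>v\<in>V - E `` {u}. x v) + (\<Sum>v\<in>E `` {u}. x v)"
      using nbrs_subset[of u] by (intro sum.subset_diff) auto
    ultimately have "(real n - 4 - (m' / 2 + 2)) * M \<le> (\<Sum>v\<in>E `` {u}. x v)"
      using sum_x by (simp only: left_diff_distrib[of "real n - 4"])
    also have "\<dots> = (q1 - degree u) * x u" by (rule eigen[OF uV])
    also have "\<dots> \<le> (2 * real n) * x u"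
    proof (rule mult_right_mono)
      have "m / (real n - 1) \<ge> 0" using N by (simp add: m_def)
      thus "q1 - real (degree u) \<le> 2 * real n" using q1_le by simp
    qed (rule x(3)[OF uV])
    finally have "(real n - 4 - (m' / 2 + 2)) * M \<le> (2 * real n) * x u" .
    moreover have "(2 / 5 * real n) * M \<le> (real n - 4 - (m' / 2 + 2)) * M"
      using m'_le N M0 by (intro mult_right_mono) auto
    ultimately have "(2 / 5 * real n) * M \<le> (2 * real n) * x u" by (rule order_trans[rotated])
    hence "(2 * real n) * (M / 5) \<le> (2 * real n) * x u" by simp
    thus ?thesis using N by simp
  qed

  have "(y u + y v)\<^sup>2 < (x u + x v)\<^sup>2" if u: "u \<in> ?V" and v: "v \<in> ?V" for u v
  proof -
    have yb: "\<bar>y t\<bar> \<le> b" if "t \<in> ?V" for t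
    proof -
      have "(y t)\<^sup>2 \<le> sqnorm ?V y" unfolding sqnorm_def using that by (intro member_le_sum) auto
      thus ?thesis unfolding b_def by (metis real_sqrt_abs real_sqrt_le_mono)
    qed
    have "\<bar>y u + y v\<bar> \<le> 2 * b" using yb[OF u] yb[OF v] by linarith
    hence "(y u + y v)\<^sup>2 \<le> (2 * b)\<^sup>2" using b0 by (intro abs_le_square_iff[THEN iffD1]) simp
    hence "(real n)\<^sup>2 * (y u + y v)\<^sup>2 \<le> (real n)\<^sup>2 * (2 * b)\<^sup>2" by (rule mult_left_mono) simp
    also have "\<dots> = 4 * (real n * b)\<^sup>2" by (simp add: power_mult_distrib)
    also have "\<dots> \<le> 4 * 10\<^sup>2" using nb b0 by (intro mult_left_mono power_mono) auto
    also have "\<dots> < 4 / 25 * real n" using N by simp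
    also have "\<dots> \<le> 4 / 25 * real n * (real n * M\<^sup>2)" using M2 N by simp
    also have "\<dots> = (real n)\<^sup>2 * (2 * M / 5)\<^sup>2" by (simp add: power2_eq_square)
    also have "\<dots> \<le> (real n)\<^sup>2 * (x u + x v)\<^sup>2"
      using x_ge[OF u] x_ge[OF v] M0 by (intro mult_left_mono power_mono) auto
    finally show ?thesis by (simp add: mult_less_cancel_left)
  qed
  thus ?thesis using w c by blast
qed

end

section \<open>The extremal graph\<close>

lemma simple_graph_parcs:
  fixes G :: ngraph
  assumes "pair_graph G" "pverts G = {0..<n}"
  shows "simple_graph {0..<n} (parcs G)"
proof -
  interpret pair_graph G by fact
  show ?thesis
  proof (rule simple_graph.intro)
    show "parcs G \<subseteq> {0..<n} \<times> {0..<n}"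
      using in_arcsD1 in_arcsD2 by (auto simp flip: assms(2))
    show "(v, u) \<in> parcs G" if "(u, v) \<in> parcs G" for u v
      using pair_sym_arcs that by (simp add: symmetric_def sym_def)
    show "(u, u) \<notin> parcs G" for u
      using pair_no_loops[of "(u, u)"] by auto
  qed simp
qed

lemma out_degree_with_proj: "out_degree (with_proj G) i = card (parcs G `` {i})"
proof -
  have "out_arcs (with_proj G) i = Pair i ` (parcs G `` {i})" by (auto simp: out_arcs_def)
  thus ?thesis by (simp add: out_degree_def card_image inj_on_def)
qed

lemma signless_laplacian_index:
  assumes "pverts G = {0..<n}" "i < n" "j < n"
  shows "signless_laplacian G $$ (i, j) =
    (if i = j then real (card (parcs G `` {i})) else 0) + (if (i, j) \<in> parcs G then 1 else 0)"
  using assms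
  by (simp add: signless_laplacian_def degree_mat_def adjacency_mat_def mat_diag_def out_degree_with_proj)

lemma signless_laplacian_carrier: "pverts G = {0..<n} \<Longrightarrow> signless_laplacian G \<in> carrier_mat n n"
  by (simp add: signless_laplacian_def degree_mat_def adjacency_mat_def mat_diag_def)

lemma signless_laplacian_row_sum:
  assumes G: "pair_graph G" "pverts G = {0..<n}" and "i < n"
  shows "(\<Sum>j\<in>{0..<n}. signless_laplacian G $$ (i, j) * x j) =
    real (card (parcs G `` {i})) * x i + (\<Sum>j\<in>parcs G `` {i}. x j)"
proof -
  interpret simple_graph "{0..<n}" "parcs G" using simple_graph_parcs[OF G] .
  have "(\<Sum>j\<in>{0..<n}. signless_laplacian G $$ (i, j) * x j) = (\<Sum>j\<in>{0..<n}.
      (if i = j then real (degree i) * x j else 0) + (if j \<in> parcs G `` {i} then x j else 0))"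
    by (intro sum.cong refl) (simp add: signless_laplacian_index[OF G(2) \<open>i < n\<close>] distrib_right)
  also have "\<dots> = real (degree i) * x i + (\<Sum>j\<in>{0..<n} \<inter> parcs G `` {i}. x j)"
    using \<open>i < n\<close> by (simp add: sum.distrib sum.inter_restrict)
  also have "{0..<n} \<inter> parcs G `` {i} = parcs G `` {i}" using nbrs_subset by blast
  finally show ?thesis .
qed

lemma quad_form_signless_laplacian:
  assumes G: "pair_graph G" "pverts G = {0..<n}"
  shows "quad_form n (\<lambda>i j. signless_laplacian G $$ (i, j)) x = edge_form (parcs G) x"
proof -
  interpret simple_graph "{0..<n}" "parcs G" using simple_graph_parcs[OF G] .
  have "quad_form n (\<lambda>i j. signless_laplacian G $$ (i, j)) x =
      (\<Sum>i\<in>{0..<n}. x i * (\<Sum>j\<in>{0..<n}. signless_laplacian G $$ (i, j) * x j))"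
    by (simp add: quad_form_def sum_distrib_left mult_ac)
  also have "\<dots> = (\<Sum>i\<in>{0..<n}. real (degree i) * (x i)\<^sup>2 + (\<Sum>j\<in>parcs G `` {i}. x i * x j))"
    by (intro sum.cong refl)
       (simp add: signless_laplacian_row_sum[OF G], simp add: power2_eq_square distrib_left sum_distrib_left mult_ac)
  finally show ?thesis by (simp add: edge_form_expand sum_arcs sum.distrib)
qed

context
  fixes G :: ngraph and n :: nat
  assumes G: "pair_graph G" "pverts G = {0..<n}" and n: "n > 0"
begin

lemma signless_laplacian_symmetric:
  assumes "i < n" "j < n"
  shows "signless_laplacian G $$ (i, j) = signless_laplacian G $$ (j, i)"
  using simple_graph.E_sym[OF simple_graph_parcs[OF G]] assms by (auto simp: signless_laplacian_index[OF G(2)])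

lemmas spectrum = real_symmetric_spectrum[OF signless_laplacian_carrier[OF G(2)] n signless_laplacian_symmetric,
    folded Q_eigenvalues_def, unfolded quad_form_signless_laplacian[OF G]]

lemma edge_form_le_Q_eig: "edge_form (parcs G) x \<le> Q_eig 1 G * sqnorm {0..<n} x"
  using spectrum(2) by (simp add: Q_eig_def)

lemma edge_form_ge_Q_eig: "Q_eig n G * sqnorm {0..<n} x \<le> edge_form (parcs G) x"
  using spectrum(4) by (simp add: Q_eig_def)

lemma Q_eig_min_attained: "\<exists>y. sqnorm {0..<n} y = 1 \<and> edge_form (parcs G) y = Q_eig n G"
  using spectrum(3) by (simp add: Q_eig_def)

lemma Q_eig_1_attained_nonneg:
  "\<exists>x. sqnorm {0..<n} x = 1 \<and> edge_form (parcs G) x = Q_eig 1 G \<and> (\<forall>u. 0 \<le> x u)"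
proof -
  obtain x where x: "sqnorm {0..<n} x = 1" "edge_form (parcs G) x = Q_eig 1 G"
    using spectrum(1) by (auto simp: Q_eig_def)
  let ?x = "\<lambda>u. \<bar>x u\<bar>"
  have nx: "sqnorm {0..<n} ?x = 1" using x(1) by (simp add: sqnorm_def)
  have "(x u + x v)\<^sup>2 \<le> (\<bar>x u\<bar> + \<bar>x v\<bar>)\<^sup>2" for u v
    by (metis abs_triangle_ineq abs_ge_zero power2_abs power_mono)
  hence "edge_form (parcs G) x \<le> edge_form (parcs G) ?x"
    unfolding edge_form_def by (intro divide_right_mono sum_mono) auto
  hence "edge_form (parcs G) ?x = Q_eig 1 G" using x(2) edge_form_le_Q_eig[of ?x] nx by simp
  thus ?thesis using nx by (intro exI[of _ ?x]) auto
qed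

lemma Q_eig_1_eigenvector:
  assumes "edge_form (parcs G) x = Q_eig 1 G * sqnorm {0..<n} x" "u < n"
  shows "(\<Sum>v\<in>parcs G `` {u}. x v) = (Q_eig 1 G - card (parcs G `` {u})) * x u"
  using quad_form_max_eigen[where a = "\<lambda>i j. signless_laplacian G $$ (i, j)" and M = "Q_eig 1 G" and n = n,
      unfolded quad_form_signless_laplacian[OF G], OF signless_laplacian_symmetric edge_form_le_Q_eig assms]
    signless_laplacian_row_sum[OF G assms(2), of x]
  by (simp add: left_diff_distrib)

end

lemma connected_graph_on_degree_pos:
  assumes "connected_graph_on n G" "n \<ge> 2" "u < n"
  shows "1 \<le> card (parcs G `` {u})"
proof -
  have G: "pair_graph G" "pverts G = {0..<n}" and con: "Digraph_Component.connected (with_proj G)"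
    using assms by (auto simp: connected_graph_on_def)
  interpret simple_graph "{0..<n}" "parcs G" using simple_graph_parcs[OF G] .
  obtain v where v: "v < n" "v \<noteq> u"
    using assms(2) by (metis less_le_trans one_less_numeral_iff pos2 semiring_norm(76) zero_neq_one)
  have "(u, v) \<in> rtrancl_on {0..<n} ((parcs G)\<^sup>s)"
    using con v \<open>u < n\<close> by (simp add: connected_conv G)
  then obtain z where "(u, z) \<in> (parcs G)\<^sup>s"
    using v by (cases rule: converse_rtrancl_on_cases) auto
  hence "z \<in> parcs G `` {u}" using E_sym by (auto simp: symcl_def)
  thus ?thesis by (metis Suc_leI card_gt_0_iff empty_iff finite_nbrs One_nat_def)
qed

lemma K_plus_simps [simp]:
  "pverts (K_plus n) = {0..<n}"
  "parcs (K_plus n) = {(u, v). u < n - 1 \<and> v < n - 1 \<and> u \<noteq> v} \<union> {(0, n - 1), (n - 1, 0)}"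
  by (simp_all add: K_plus_def)

lemma pair_graph_K_plus:
  assumes "n \<ge> 2"
  shows "pair_graph (K_plus n)"
proof -
  have sub: "parcs (K_plus n) \<subseteq> {0..<n} \<times> {0..<n}" using assms by auto
  hence "finite (parcs (K_plus n))" by (rule finite_subset) simp
  moreover have "symmetric (with_proj (K_plus n))" by (auto simp: symmetric_def sym_def)
  moreover have "fst e \<noteq> snd e" if "e \<in> parcs (K_plus n)" for e using that assms by auto
  moreover have "fst e \<in> {0..<n}" "snd e \<in> {0..<n}" if "e \<in> parcs (K_plus n)" for e
    using that sub by (metis mem_Sigma_iff prod.collapse subsetD)+
  ultimately show ?thesis by unfold_locales (simp_all del: K_plus_simps(2))
qed

lemma connected_K_plus:
  assumes "n \<ge> 2"
  shows "connected_graph_on n (K_plus n)"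
proof -
  let ?R = "rtrancl_on {0..<n} ((parcs (K_plus n))\<^sup>s)"
  have step: "(u, v) \<in> ?R" if "(u, v) \<in> parcs (K_plus n)" "u < n" "v < n" for u v
    by (rule rtrancl_on_into_rtrancl_on[OF rtrancl_on_refl])
       (use that in \<open>simp_all add: symcl_def del: K_plus_simps(2)\<close>)
  have 0: "(u, 0) \<in> ?R" "(0, u) \<in> ?R" if "u < n" for u
  proof -
    have "u \<noteq> 0 \<Longrightarrow> (u, 0) \<in> parcs (K_plus n) \<and> (0, u) \<in> parcs (K_plus n)"
      using that assms by (cases "u = n - 1") simp_all
    thus "(u, 0) \<in> ?R" "(0, u) \<in> ?R" using step[of u 0] step[of 0 u] assms that
      by (cases "u = 0"; simp del: K_plus_simps(2))+
  qed
  have "(u, v) \<in> ?R" if "u < n" "v < n" for u v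
    using 0(1)[OF that(1)] 0(2)[OF that(2)] by (rule rtrancl_on_trans)
  hence "Digraph_Component.connected (with_proj (K_plus n))"
    using assms by (simp add: connected_conv del: K_plus_simps(2))
  thus ?thesis using pair_graph_K_plus[OF assms] by (simp add: connected_graph_on_def)
qed

lemma Q_spread_K_plus_ge:
  assumes "n \<ge> 2"
  shows "2 * real n - 5 \<le> Q_spread (K_plus n)"
proof -
  let ?E = "parcs (K_plus n)" and ?w = "n - 1"
  note K = pair_graph_K_plus[OF assms] K_plus_simps(1)
  interpret simple_graph "{0..<n}" ?E by (rule simple_graph_parcs[OF K])
  have V: "{0..<n} = insert ?w {0..<?w}" using assms by auto
  have nbr: "?E `` {?w} = {0}" using assms by auto
  have del: "delete_vertex ?E ?w = complement_arcs {0..<?w} {}"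
    by (auto simp: delete_vertex_def complement_arcs_def)
  interpret empty: simple_graph "{0..<?w}" "{}" by unfold_locales auto

  define x where "x = (\<lambda>u. if u = ?w then 0 else 1 :: real)"
  have x1: "u < ?w \<Longrightarrow> x u = 1" for u by (simp add: x_def)
  have nx: "sqnorm {0..<?w} x = real ?w" by (simp add: sqnorm_def x1)
  have "edge_form (delete_vertex ?E ?w) x = (real ?w - 2) * real ?w + (real ?w)\<^sup>2"
    unfolding del using empty.edge_form_complement[of x] nx by (simp add: x1 edge_form_def)
  moreover have "edge_form (delete_vertex ?E ?w) x \<le> edge_form ?E x"
    unfolding edge_form_delete_vertex[of x ?w] by (simp add: sum_nonneg del: K_plus_simps(2))
  ultimately have "edge_form ?E x \<ge> (2 * real n - 4) * real ?w"
    using assms by (simp add: of_nat_diff power2_eq_square algebra_simps del: K_plus_simps(2))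
  moreover have "sqnorm {0..<n} x = real ?w"
    using nx unfolding V sqnorm_def by (subst sum.insert) (auto simp: x_def)
  ultimately have "(2 * real n - 4) * real ?w \<le> Q_eig 1 (K_plus n) * real ?w"
    using edge_form_le_Q_eig[OF K, of x] assms by (metis order_trans pos2 order_less_le_trans)
  hence q1: "2 * real n - 4 \<le> Q_eig 1 (K_plus n)" using assms by simp

  define y where "y = (\<lambda>u. if u = ?w then 1 else 0 :: real)"
  have "sqnorm {0..<n} y = 1"
    using assms by (simp add: y_def sqnorm_def if_distrib[of "\<lambda>x. x\<^sup>2"] cong: if_cong)
  moreover have "edge_form (delete_vertex ?E ?w) y = 0"
    by (auto simp: edge_form_def delete_vertex_def y_def intro!: sum.neutral)
  hence "edge_form ?E y = 1"
    using edge_form_delete_vertex[of y ?w] assms unfolding nbr by (simp add: y_def del: K_plus_simps(2))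
  ultimately have "Q_eig n (K_plus n) \<le> 1"
    using edge_form_ge_Q_eig[OF K, of y] assms by (simp del: K_plus_simps(2))
  thus ?thesis using q1 by (simp add: Q_spread_def)
qed

lemma digraph_iso_pair_graphI:
  assumes "pair_graph G" "inj_on f (pverts G)" "pverts H = f ` pverts G"
    and "parcs H = map_prod f f ` parcs G"
  shows "digraph_iso (with_proj G) (with_proj H)"
proof -
  interpret pair_graph G by fact
  let ?h = "\<lparr>iso_verts = f, iso_arcs = map_prod f f, iso_head = snd, iso_tail = fst\<rparr>"
  have "parcs G \<subseteq> pverts G \<times> pverts G" using arc_fst_in_verts arc_snd_in_verts by force
  hence "inj_on (map_prod f f) (parcs G)"
    using map_prod_inj_on[OF assms(2,2)] inj_on_subset by blast
  hence "digraph_isomorphism ?h"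
    using assms wf_digraph by (auto simp: digraph_isomorphism_def)
  moreover have "with_proj H = app_iso ?h (with_proj G)"
    using assms by (simp add: app_iso_def with_proj_def)
  ultimately show ?thesis unfolding digraph_iso_def by blast
qed

lemma Q_spread_extremal:
  assumes "n \<ge> 10000" and con: "connected_graph_on n G"
    and ge: "Q_spread (K_plus n) \<le> Q_spread G"
  shows "Q_spread G \<le> Q_spread (K_plus n)" and "digraph_iso (with_proj G) (with_proj (K_plus n))"
proof -
  let ?V = "{0..<n}" and ?E = "parcs G" and ?K = "parcs (K_plus n)"
  have n: "n \<ge> 2" "n > 0" using assms by auto
  have G: "pair_graph G" "pverts G = ?V" using con by (auto simp: connected_graph_on_def)
  note K = pair_graph_K_plus[OF n(1)] K_plus_simps(1)
  interpret simple_graph ?V ?E using simple_graph_parcs[OF G] .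
  obtain x where x: "sqnorm ?V x = 1" "edge_form ?E x = Q_eig 1 G" "\<And>u. 0 \<le> x u"
    using Q_eig_1_attained_nonneg[OF G n(2)] by blast
  obtain y where y: "sqnorm ?V y = 1" "edge_form ?E y = Q_eig n G"
    using Q_eig_min_attained[OF G n(2)] by blast
  have gap: "2 * real n - 5 \<le> Q_eig 1 G - Q_eig n G"
    using Q_spread_K_plus_ge[OF n(1)] ge G(2) by (simp add: Q_spread_def del: K_plus_simps(2))
  have "\<exists>w\<in>?V. \<exists>c. ?E `` {w} = {c} \<and>
      (\<forall>u\<in>?V - {w}. \<forall>v\<in>?V - {w}. (y u + y v)\<^sup>2 < (x u + x v)\<^sup>2)"
    using Q_eig_1_eigenvector[OF G n(2), of x] connected_graph_on_degree_pos[OF con n(1)] assms(1)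
      x y edge_form_ge_Q_eig[OF G n(2)] gap
    by (intro large_gap_imp_pendant) auto
  then obtain w c where w: "w < n" "?E `` {w} = {c}"
    and less: "\<And>u v. u \<in> ?V - {w} \<Longrightarrow> v \<in> ?V - {w} \<Longrightarrow> (y u + y v)\<^sup>2 < (x u + x v)\<^sup>2"
    by auto
  have c: "c < n" "c \<noteq> w" using w nbrs_subset[of w] by auto

  define t where "t = Transposition.transpose w (n - 1)"
  define f where "f = Transposition.transpose (t c) 0 \<circ> t"
  have tc: "t c < n" "t c \<noteq> n - 1" using c w(1) n by (auto simp: t_def transpose_def)
  have f_perm: "f permutes ?V"
    unfolding f_def t_def using w(1) tc n
    by (intro permutes_compose permutes_swap_id) (auto simp: t_def)
  have f: "f w = n - 1" "f c = 0" using tc n by (auto simp: f_def t_def transpose_def)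
  define g where "g = inv_into UNIV f"
  have gf: "g (f u) = u" and fg: "f (g u) = u" for u
    using permutes_inverses[OF f_perm] by (simp_all add: g_def)
  have g_perm: "g permutes ?V" unfolding g_def using f_perm by (rule permutes_inv)
  have f_lt: "f u < n \<longleftrightarrow> u < n" and g_lt: "g u < n \<longleftrightarrow> u < n" for u
    using permutes_in_image[OF f_perm, of u] permutes_in_image[OF g_perm, of u] by auto
  have f_inj: "f u = f v \<longleftrightarrow> u = v" for u v by (metis gf)

  define F where "F = map_prod f f ` ?E"
  have F_sub: "F \<subseteq> ?K"
  proof
    fix e assume "e \<in> F"
    then obtain u v where e: "e = (f u, f v)" "(u, v) \<in> ?E" by (auto simp: F_def)
    have uv: "u < n" "v < n" "u \<noteq> v" using e(2) E_sub E_irrefl by auto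
    consider "u = w" | "v = w" | "u \<noteq> w" "v \<noteq> w" by blast
    thus "e \<in> ?K"
    proof cases
      case 1
      hence "v = c" using w e by auto
      thus ?thesis using 1 e f by simp
    next
      case 2
      hence "u = c" using w E_sym[OF e(2)] by auto
      thus ?thesis using 2 e f by simp
    next
      case 3
      hence "f u \<noteq> n - 1" "f v \<noteq> n - 1" using f f_inj by metis+
      thus ?thesis using e uv f_lt[of u] f_lt[of v] f_inj[of u v] by auto
    qed
  qed
  have finK: "finite ?K" using simple_graph.finite_E[OF simple_graph_parcs[OF K]] .
  have nF: "(n - 1, 0) \<in> F" "(0, n - 1) \<in> F"
    using w(2) E_sym f unfolding F_def by (force simp: map_prod_def image_iff)+
  have missing: "g u \<in> ?V - {w} \<and> g v \<in> ?V - {w}" if "(u, v) \<in> ?K - F" for u v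
  proof -
    have "u < n - 1" "v < n - 1" using that nF by auto
    thus ?thesis using g_lt[of u] g_lt[of v] f fg by auto
  qed
  define R where "R = (\<lambda>z :: nat \<Rightarrow> real. (\<Sum>(u, v)\<in>?K - F. (z (g u) + z (g v))\<^sup>2) / 2)"
  have form: "edge_form ?K (z \<circ> g) = edge_form ?E z + R z" for z
  proof -
    have "(\<Sum>(u, v)\<in>?K. (z (g u) + z (g v))\<^sup>2) =
        (\<Sum>(u, v)\<in>?K - F. (z (g u) + z (g v))\<^sup>2) + (\<Sum>(u, v)\<in>F. (z (g u) + z (g v))\<^sup>2)"
      using F_sub finK by (rule sum.subset_diff)
    also have "(\<Sum>(u, v)\<in>F. (z (g u) + z (g v))\<^sup>2) = (\<Sum>(u, v)\<in>?E. (z u + z v)\<^sup>2)"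
      unfolding F_def using f_inj by (subst sum.reindex) (auto simp: inj_on_def gf case_prod_unfold)
    finally show ?thesis by (simp add: edge_form_def R_def add_divide_distrib)
  qed
  have norm: "sqnorm ?V (z \<circ> g) = sqnorm ?V z" for z
    using sum.permute[OF g_perm, of "\<lambda>i. (z i)\<^sup>2"] by (simp add: sqnorm_def comp_def)
  have "Q_eig 1 G + R x \<le> Q_eig 1 (K_plus n)"
    using edge_form_le_Q_eig[OF K n(2), of "x \<circ> g"] x unfolding form norm by simp
  moreover have "Q_eig n (K_plus n) \<le> Q_eig n G + R y"
    using edge_form_ge_Q_eig[OF K n(2), of "y \<circ> g"] y unfolding form norm by simp
  ultimately have spread: "Q_spread G + (R x - R y) \<le> Q_spread (K_plus n)"
    using G(2) by (simp add: Q_spread_def del: K_plus_simps(2))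
  have "?K - F = {}"
  proof (rule ccontr)
    assume "?K - F \<noteq> {}"
    hence "R y < R x"
      unfolding R_def using finK less missing
      by (intro divide_strict_right_mono sum_strict_mono) auto
    thus False using spread ge by simp
  qed
  hence "?K = F" using F_sub by blast
  thus "digraph_iso (with_proj G) (with_proj (K_plus n))"
    using G permutes_inj[OF f_perm] permutes_image[OF f_perm] unfolding F_def
    by (intro digraph_iso_pair_graphI[of G f]) (auto intro: inj_on_subset simp del: K_plus_simps(2))
  show "Q_spread G \<le> Q_spread (K_plus n)"
    using spread \<open>?K - F = {}\<close> by (simp add: R_def del: K_plus_simps(2))
qed

theorem mainTheorem2:
  shows "\<exists>n0::nat. \<forall>n\<ge>n0.
           connected_graph_on n (K_plus n) \<and>
           (\<forall>G. connected_graph_on n G \<longrightarrow> Q_spread G \<le> Q_spread (K_plus n)) \<and>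
           (\<forall>G. connected_graph_on n G \<and> Q_spread G = Q_spread (K_plus n) \<longrightarrow>
                digraph_iso (with_proj G) (with_proj (K_plus n)))"
proof (intro exI[of _ 10000] allI impI conjI)
  fix n :: nat assume n: "n \<ge> 10000"
  show "connected_graph_on n (K_plus n)" using n by (intro connected_K_plus) simp
  show "Q_spread G \<le> Q_spread (K_plus n)" if "connected_graph_on n G" for G
    using Q_spread_extremal(1)[OF n that] by linarith
  show "digraph_iso (with_proj G) (with_proj (K_plus n))"
    if "connected_graph_on n G \<and> Q_spread G = Q_spread (K_plus n)" for G
    using Q_spread_extremal(2)[OF n] that by simp
qed

end
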